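(* Let $\mathbf{X}$ and $\mathbf{Y}$ be topological spaces with carriers $X$ and $Y$, let $\mathcal U=\{U_i\}_{i\in I}$ be an indexed base of $\mathbf X$ and $\mathcal V=\{V_j\}_{j\in J}$ an indexed base of $\mathbf Y$, where $I,J\subseteq\mathbb N$, and let $f:E\to Y$ with $E\subseteq X$. Suppose the set $J$ is recursively enumerable and there exists a recursively enumerable subset $H$ of $I^3$ such that for all $i_1,i_2\in I$, $$U_{i_1}\cap U_{i_2}=\bigcup\{U_i\mid (i_1,i_2,i)\in H\}.$$ If $f$ is $(\mathcal U,\mathcal V)$-computable, then there exists a recursively enumerable $(\mathcal U,\mathcal V)$-approximation system for $f$.
   Context: A $(\mathcal U,\mathcal V)$-approximation system for $f$ is a subset $R\subseteq I\times J$ such that for every $x\in E$ and every $j\in J$: $f(x)\in V_j$ if and only if there exists $i$ with $(i,j)\in R$ and $x\in U_i$. For $x\in X$ let $[x]_{\mathcal U}=\{i\in I\mid x\in U_i\}$ and for $y\in Y$ let $[y]_{\mathcal V}=\{j\in J\mid y\in V_j\}$. The function $f$ is $(\mathcal U,\mathcal V)$-computable if there exists an enumeration operator $F:\mathcal P(\mathbb N)\to\mathcal P(\mathbb N)$ such that $[f(x)]_{\mathcal V}=F([x]_{\mathcal U})$ for every $x\in E$. *)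

theory Defs
  imports "HOL-Analysis.Abstract_Topology" "HOL-Library.Nat_Bijection" "HOL-Library.FuncSet"
begin

text \<open>
  Total recursive functions: the least class containing zero, successor and the projections and
  closed under composition, primitive recursion and minimisation of regular functions.
  \<open>recfn n f\<close> says that the restriction of \<open>f\<close> to lists of length \<open>n\<close> is an \<open>n\<close>-ary recursive
  function; by rule \<open>ext\<close> the values of \<open>f\<close> on lists of any other length are irrelevant.
\<close>

inductive recfn :: "nat \<Rightarrow> (nat list \<Rightarrow> nat) \<Rightarrow> bool" where
  zero: "recfn n (\<lambda>xs. 0)"
| succ: "recfn 1 (\<lambda>xs. Suc (hd xs))"
| proj: "i < n \<Longrightarrow> recfn n (\<lambda>xs. xs ! i)"
| comp: "recfn (length gs) f \<Longrightarrow> (\<And>g. g \<in> set gs \<Longrightarrow> recfn n g) \<Longrightarrow>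
           recfn n (\<lambda>xs. f (map (\<lambda>g. g xs) gs))"
| prim: "recfn n f \<Longrightarrow> recfn (Suc (Suc n)) g \<Longrightarrow>
           recfn (Suc n) (\<lambda>xs. rec_nat (f (tl xs)) (\<lambda>k r. g (k # r # tl xs)) (hd xs))"
| mu: "recfn (Suc n) f \<Longrightarrow> (\<And>xs. length xs = n \<Longrightarrow> \<exists>y. f (y # xs) = 0) \<Longrightarrow>
           recfn n (\<lambda>xs. LEAST y. f (y # xs) = 0)"
| ext: "recfn n f \<Longrightarrow> (\<And>xs. length xs = n \<Longrightarrow> g xs = f xs) \<Longrightarrow> recfn n g"

definition re_set :: "nat set \<Rightarrow> bool" where
  "re_set A \<longleftrightarrow> A = {} \<or> (\<exists>f. recfn 1 f \<and> A = range (\<lambda>k. f [k]))"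

text \<open>Sets of pairs and triples are coded as sets of numbers by the Cantor pairing function.\<close>

definition re_set2 :: "(nat \<times> nat) set \<Rightarrow> bool" where
  "re_set2 A \<longleftrightarrow> re_set (prod_encode ` A)"

definition re_set3 :: "(nat \<times> nat \<times> nat) set \<Rightarrow> bool" where
  "re_set3 A \<longleftrightarrow> re_set ((\<lambda>(a, b, c). prod_encode (a, prod_encode (b, c))) ` A)"

text \<open>
  \<open>set_decode u\<close> is the finite set with canonical index \<open>u\<close>, i.e. the set of positions of the
  binary digits 1 of \<open>u\<close>.
\<close>

definition enumeration_operator :: "(nat set \<Rightarrow> nat set) \<Rightarrow> bool" where
  "enumeration_operator F \<longleftrightarrow>
     (\<exists>W. re_set2 W \<and> (\<forall>A. F A = {x. \<exists>u. (x, u) \<in> W \<and> set_decode u \<subseteq> A}))"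

definition indexed_base :: "'a topology \<Rightarrow> nat set \<Rightarrow> (nat \<Rightarrow> 'a set) \<Rightarrow> bool" where
  "indexed_base X I U \<longleftrightarrow>
     (\<forall>i\<in>I. openin X (U i)) \<and> (\<forall>S. openin X S \<longrightarrow> (\<exists>K\<subseteq>I. S = (\<Union>i\<in>K. U i)))"

definition index_set :: "nat set \<Rightarrow> (nat \<Rightarrow> 'a set) \<Rightarrow> 'a \<Rightarrow> nat set" where
  "index_set I U x = {i \<in> I. x \<in> U i}"

definition approximation_system ::
  "nat set \<Rightarrow> (nat \<Rightarrow> 'a set) \<Rightarrow> nat set \<Rightarrow> (nat \<Rightarrow> 'b set) \<Rightarrow> 'a set \<Rightarrow> ('a \<Rightarrow> 'b)
     \<Rightarrow> (nat \<times> nat) set \<Rightarrow> bool" where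
  "approximation_system I U J V E f R \<longleftrightarrow>
     R \<subseteq> I \<times> J \<and> (\<forall>x\<in>E. \<forall>j\<in>J. f x \<in> V j \<longleftrightarrow> (\<exists>i. (i, j) \<in> R \<and> x \<in> U i))"

definition computable_wrt ::
  "nat set \<Rightarrow> (nat \<Rightarrow> 'a set) \<Rightarrow> nat set \<Rightarrow> (nat \<Rightarrow> 'b set) \<Rightarrow> 'a set \<Rightarrow> ('a \<Rightarrow> 'b) \<Rightarrow> bool" where
  "computable_wrt I U J V E f \<longleftrightarrow>
     (\<exists>F. enumeration_operator F \<and> (\<forall>x\<in>E. index_set J V (f x) = F (index_set I U x)))"

end

theory Submission
  imports Defs
begin

text \<open>
  Let \<open>W\<close> generate the enumeration operator of \<open>f\<close>. The set \<open>H\<close> effectively enumerates indices of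
  basic sets whose union is a finite intersection \<open>\<Inter>a\<in>D. U a\<close>: start with an arbitrary basic set
  and intersect with the sets \<open>U a\<close> one after the other. Put \<open>(i, j)\<close> into \<open>R\<close> when some
  \<open>(j, u) \<in> W\<close> with \<open>j \<in> J\<close> has such an index \<open>i\<close> for \<open>D = set_decode u\<close>. The set \<open>I\<close> need not be
  recursively enumerable, so the start is restricted to indices \<open>i\<close> with some \<open>(i, i, k) \<in> H\<close>; this
  loses only indices of empty sets. That \<open>R\<close> is recursively enumerable follows from the closure of
  the \<open>\<Sigma>\<^sub>1\<close> predicates under conjunction, disjunction, existential and bounded universal
  quantification.
\<close>

subsection \<open>Recursive functions and relations\<close>

lemma recfn_subst:
  assumes f: "recfn (length gs + n) f" and gs: "\<And>g. g \<in> set gs \<Longrightarrow> recfn (d + n) g"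
  shows "recfn (d + n) (\<lambda>xs. f (map (\<lambda>g. g xs) gs @ drop d xs))"
proof -
  let ?hs = "gs @ map (\<lambda>i xs. xs ! i) [d..<d + n]"
  have "recfn (d + n) (\<lambda>xs. f (map (\<lambda>g. g xs) ?hs))"
    using f gs by (intro recfn.comp) (auto intro: recfn.proj)
  moreover have "map (\<lambda>i. xs ! i) [d..<d + n] = drop d xs" if "length xs = d + n" for xs :: "nat list"
    using that by (auto intro: nth_equalityI)
  ultimately show ?thesis
    by (elim recfn.ext) (simp add: o_def)
qed

lemma recfn_hd: "recfn (Suc n) hd"
  by (rule recfn.ext[OF recfn.proj[of 0]]) (auto simp: length_Suc_conv)

lemma recfn_tl: "recfn n g \<Longrightarrow> recfn (Suc n) (\<lambda>xs. g (tl xs))"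
  using recfn_subst[of "[]" n g 1] by (simp add: drop_Suc)

lemma recfn_Suc: "recfn n t \<Longrightarrow> recfn n (\<lambda>xs. Suc (t xs))"
  using recfn.comp[of "[t]" "\<lambda>xs. Suc (hd xs)" n] recfn.succ by simp

text \<open>\<open>recfn.prim\<close> with the counter replaced by \<open>t\<close>. The curried
  step \<open>s\<close> allows recursions written with bound variables, which become leading entries
  of the argument list.\<close>

lemma recfn_rec:
  assumes "recfn n b" "recfn (Suc (Suc n)) (\<lambda>xs. s (hd xs) (hd (tl xs)) (tl (tl xs)))" "recfn n t"
  shows "recfn n (\<lambda>xs. rec_nat (b xs) (\<lambda>k r. s k r xs) (t xs))"
  using recfn_subst[where gs = "[t]" and d = 0 and n = n, simplified, OF recfn.prim[OF assms(1,2)]] assms(3)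
  by simp

lemma recfn_const: "recfn n (\<lambda>xs. k)"
  by (induction k) (auto intro: recfn.zero recfn_Suc)

lemmas recfn_base = recfn_hd recfn_const recfn_Suc recfn_tl

lemma recfn_add:
  assumes "recfn n s" "recfn n t"
  shows "recfn n (\<lambda>xs. s xs + t xs)"
proof -
  have "rec_nat a (\<lambda>_. Suc) b = a + b" for a b :: nat
    by (induction b) auto
  with recfn_rec[of n s "\<lambda>_ r _. Suc r" t] assms show ?thesis
    by (simp add: recfn_base)
qed

lemma recfn_diff:
  assumes "recfn n s" "recfn n t"
  shows "recfn n (\<lambda>xs. s xs - t xs)"
proof -
  have pred: "recfn m (\<lambda>xs. t xs - 1)" if "recfn m t" for m t
  proof -
    have "rec_nat 0 (\<lambda>k _. k) a = a - 1" for a :: nat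
      by (cases a) auto
    with recfn_rec[of m "\<lambda>_. 0" "\<lambda>k _ _. k" t] that show ?thesis
      by (simp add: recfn_base)
  qed
  have "rec_nat a (\<lambda>_ r. r - 1) b = a - b" for a b :: nat
    by (induction b) auto
  with recfn_rec[of n s "\<lambda>_ r _. r - 1" t] assms show ?thesis
    by (simp add: recfn_base pred[simplified])
qed

section \<open>Decidable relations, bounded quantifiers and definition by cases\<close>

text \<open>Zero stands for truth, in agreement with \<open>recfn.mu\<close>, which searches for
  zeros; conjunction then amounts to the vanishing of a sum.\<close>

definition recrel :: "nat \<Rightarrow> (nat list \<Rightarrow> bool) \<Rightarrow> bool" where
  "recrel n P \<longleftrightarrow> recfn n (\<lambda>xs. if P xs then 0 else 1)"

lemma recrelI:
  assumes "recfn n t" "\<And>xs. length xs = n \<Longrightarrow> P xs \<longleftrightarrow> t xs = 0"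
  shows "recrel n P"
proof -
  \<comment> \<open>Double truncated subtraction sends every nonzero value to 1.\<close>
  have "recfn n (\<lambda>xs. 1 - (1 - t xs))"
    by (intro recfn_diff recfn_const assms(1))
  then show ?thesis
    unfolding recrel_def by (rule recfn.ext) (use assms(2) in auto)
qed

lemma recrelE:
  assumes "recrel n P"
  obtains t where "recfn n t" "P = (\<lambda>xs. t xs = 0)"
  using assms unfolding recrel_def by (elim that) auto

lemma recrel_eq: "recfn n s \<Longrightarrow> recfn n t \<Longrightarrow> recrel n (\<lambda>xs. s xs = t xs)"
  by (rule recrelI[of n "\<lambda>xs. (s xs - t xs) + (t xs - s xs)"]) (auto intro!: recfn_add recfn_diff)

lemma recrel_not: "recrel n P \<Longrightarrow> recrel n (\<lambda>xs. \<not> P xs)"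
  by (elim recrelE, rule recrelI[OF recfn_diff[OF recfn_const[of n 1]]]) auto

lemma recrel_conj: "recrel n P \<Longrightarrow> recrel n Q \<Longrightarrow> recrel n (\<lambda>xs. P xs \<and> Q xs)"
  by (elim recrelE, rule recrelI[OF recfn_add]) auto

lemma recrel_disj: "recrel n P \<Longrightarrow> recrel n Q \<Longrightarrow> recrel n (\<lambda>xs. P xs \<or> Q xs)"
  using recrel_not[OF recrel_conj[OF recrel_not recrel_not]] by simp

text \<open>A sum of natural numbers over \<open>y < t xs\<close> vanishes exactly when each summand
  does, and such a sum is computed by primitive recursion.\<close>

lemma recrel_ball_less:
  assumes "recrel (Suc n) (\<lambda>xs. P (hd xs) (tl xs))" and t: "recfn n t"
  shows "recrel n (\<lambda>xs. \<forall>y<t xs. P y xs)"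
proof -
  obtain p where p: "recfn (Suc n) p" "(\<lambda>xs. P (hd xs) (tl xs)) = (\<lambda>xs. p xs = 0)"
    using assms(1) by (rule recrelE)
  have P: "P y xs \<longleftrightarrow> p (y # xs) = 0" for y xs
    using fun_cong[OF p(2), of "y # xs"] by simp
  \<comment> \<open>The recursion step receives the accumulated sum as its second argument, which
    \<open>p\<close> has to skip.\<close>
  have "recfn (Suc (Suc n)) (\<lambda>xs. p (hd xs # tl (tl xs)))"
    using recfn_subst[of "[hd]" n p 2] p(1) recfn_hd by (simp add: drop_Suc numeral_2_eq_2)
  then have "recfn n (\<lambda>xs. rec_nat 0 (\<lambda>k r. r + p (k # xs)) (t xs))"
    by (intro recfn_rec recfn_add recfn_base t)
  moreover have "rec_nat 0 (\<lambda>k r. r + p (k # xs)) m = 0 \<longleftrightarrow> (\<forall>y<m. P y xs)" for m xs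
    by (induction m) (auto simp: P less_Suc_eq)
  ultimately show ?thesis
    by (auto intro: recrelI)
qed

lemma recrel_bex_less:
  assumes "recrel (Suc n) (\<lambda>xs. P (hd xs) (tl xs))" "recfn n t"
  shows "recrel n (\<lambda>xs. \<exists>y<t xs. P y xs)"
  using recrel_not[OF recrel_ball_less[where P = "\<lambda>y xs. \<not> P y xs", OF recrel_not]] assms by simp

lemma recfn_if:
  assumes "recrel n P" "recfn n s" "recfn n t"
  shows "recfn n (\<lambda>xs. if P xs then s xs else t xs)"
proof -
  \<comment> \<open>The truth value is the length of the recursion: no round returns
    \<open>s xs\<close>, one round returns \<open>t xs\<close>.\<close>
  have "recfn n (\<lambda>xs. rec_nat (s xs) (\<lambda>k r. t xs) (if P xs then 0 else 1))"
    using assms by (intro recfn_rec recfn_base) (simp_all add: recrel_def)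
  then show ?thesis
    by (rule recfn.ext) auto
qed

lemma recfn_Least:
  assumes "recrel (Suc n) (\<lambda>xs. P (hd xs) (tl xs))" "\<And>xs. length xs = n \<Longrightarrow> \<exists>y. P y xs"
  shows "recfn n (\<lambda>xs. LEAST y. P y xs)"
proof -
  obtain p where p: "recfn (Suc n) p" "(\<lambda>xs. P (hd xs) (tl xs)) = (\<lambda>xs. p xs = 0)"
    using assms(1) by (rule recrelE)
  have P: "P y xs \<longleftrightarrow> p (y # xs) = 0" for y xs
    using fun_cong[OF p(2), of "y # xs"] by simp
  show ?thesis
    using recfn.mu[OF p(1)] assms(2) by (simp add: P)
qed

section \<open>Cantor pairing and its projections\<close>

lemma recfn_prod_encode:
  assumes "recfn n s" "recfn n t"
  shows "recfn n (\<lambda>xs. prod_encode (s xs, t xs))"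
proof -
  have "rec_nat 0 (\<lambda>k r. r + Suc k) m = triangle m" for m
    by (induction m) auto
  moreover have "recfn n (\<lambda>xs. rec_nat 0 (\<lambda>k r. r + Suc k) (s xs + t xs))"
    by (intro recfn_rec recfn_add recfn_base assms)
  ultimately have "recfn n (\<lambda>xs. triangle (s xs + t xs))"
    by simp
  then show ?thesis
    unfolding prod_encode_def by (simp add: recfn_add assms)
qed

definition pfst :: "nat \<Rightarrow> nat" where "pfst z = fst (prod_decode z)"
definition psnd :: "nat \<Rightarrow> nat" where "psnd z = snd (prod_decode z)"

lemma pfst_prod_encode [simp]: "pfst (prod_encode (x, y)) = x"
  and psnd_prod_encode [simp]: "psnd (prod_encode (x, y)) = y"
  and prod_encode_pfst_psnd [simp]: "prod_encode (pfst z, psnd z) = z"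
  by (simp_all add: pfst_def psnd_def)

lemma prod_encode_eq_iff_pfst_psnd: "prod_encode (x, y) = z \<longleftrightarrow> x = pfst z \<and> y = psnd z"
  by auto

lemma psnd_le: "psnd z \<le> z"
  by (metis le_prod_encode_2 prod_encode_pfst_psnd)

text \<open>By \<open>psnd_le\<close> a bounded search for the second component is enough, so
  minimisation over the first is applied to a decidable relation with a unique solution.\<close>

lemma recfn_pfst:
  assumes "recfn n t"
  shows "recfn n (\<lambda>xs. pfst (t xs))"
proof -
  have *: "(\<exists>y<Suc z. prod_encode (x, y) = z) \<longleftrightarrow> x = pfst z" for x z
    using psnd_le[of z] by (auto simp: prod_encode_eq_iff_pfst_psnd less_Suc_eq_le)
  have "recfn n (\<lambda>xs. LEAST x. \<exists>y<Suc (t xs). prod_encode (x, y) = t xs)"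
    by (intro recfn_Least recrel_bex_less recrel_eq recfn_prod_encode recfn_base assms) (simp only: *, blast)
  then show ?thesis
    by (simp only: *) (simp add: Least_equality)
qed

lemma recfn_psnd:
  assumes "recfn n t"
  shows "recfn n (\<lambda>xs. psnd (t xs))"
proof -
  have *: "prod_encode (pfst z, y) = z \<longleftrightarrow> y = psnd z" for y z
    by (simp add: prod_encode_eq_iff_pfst_psnd)
  have "recfn n (\<lambda>xs. LEAST y. prod_encode (pfst (t xs), y) = t xs)"
    by (intro recfn_Least recrel_eq recfn_prod_encode recfn_pfst recfn_base assms) (simp only: *, blast)
  then show ?thesis
    by (simp only: *) (simp add: Least_equality)
qed

section \<open>Codes of finite sequences and finite sets\<close>

text \<open>A code is an iterated pair of head and rest, with no length stored; this plays the part
  of Goedel's beta function.\<close>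

definition seq_nth :: "nat \<Rightarrow> nat \<Rightarrow> nat" where
  "seq_nth c k = pfst ((psnd ^^ k) c)"

text \<open>Pair \<open>b 0\<close> with a code of the shifted sequence; hence the induction is over
  arbitrary \<open>b\<close>.\<close>

lemma ex_seq_nth: "\<exists>c. \<forall>k\<le>n. seq_nth c k = b k"
proof (induction n arbitrary: b)
  case 0
  show ?case
    by (rule exI[of _ "prod_encode (b 0, 0)"]) (simp add: seq_nth_def)
next
  case (Suc n)
  obtain c where "\<forall>k\<le>n. seq_nth c k = b (Suc k)"
    using Suc.IH[of "\<lambda>k. b (Suc k)"] by blast
  then have "seq_nth (prod_encode (b 0, c)) k = b k" if "k \<le> Suc n" for k
    using that by (cases k) (simp_all add: seq_nth_def funpow_Suc_right del: funpow.simps(2))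
  then show ?case
    by blast
qed

lemma rec_nat_funpow: "rec_nat a (\<lambda>_. f) k = (f ^^ k) a"
  by (induction k) auto

lemma recfn_seq_nth:
  assumes "recfn n s" "recfn n t"
  shows "recfn n (\<lambda>xs. seq_nth (s xs) (t xs))"
proof -
  have "recfn n (\<lambda>xs. rec_nat (s xs) (\<lambda>k r. psnd r) (t xs))"
    by (intro recfn_rec recfn_psnd recfn_base assms)
  then show ?thesis
    unfolding seq_nth_def by (intro recfn_pfst) (simp add: rec_nat_funpow)
qed

lemma recrel_set_decode:
  assumes "recfn n s" "recfn n t"
  shows "recrel n (\<lambda>xs. s xs \<in> set_decode (t xs))"
proof -
  have parity: "recfn m (\<lambda>xs. t xs mod 2)" if "recfn m t" for m t
  proof -
    have "rec_nat 0 (\<lambda>_ r. 1 - r) a = a mod 2" for a :: nat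
      by (induction a) (auto simp: mod_Suc)
    moreover have "recfn m (\<lambda>xs. rec_nat 0 (\<lambda>_ r. 1 - r) (t xs))"
      by (intro recfn_rec recfn_diff recfn_base that)
    ultimately show ?thesis
      by simp
  qed
  have half: "recfn m (\<lambda>xs. t xs div 2)" if "recfn m t" for m t
  proof -
    \<comment> \<open>The recursion counts the odd numbers below \<open>a\<close>.\<close>
    have "rec_nat 0 (\<lambda>k r. r + k mod 2) a = a div 2" for a :: nat
      by (induction a) (auto simp: div_Suc mod_Suc)
    moreover have "recfn m (\<lambda>xs. rec_nat 0 (\<lambda>k r. r + k mod 2) (t xs))"
      by (intro recfn_rec recfn_add parity recfn_base that)
    ultimately show ?thesis
      by simp
  qed
  have "((\<lambda>r. r div 2) ^^ k) a = a div 2 ^ k" for a k :: nat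
    by (induction k) (simp_all add: div_mult2_eq[symmetric] mult.commute)
  moreover have "recfn n (\<lambda>xs. rec_nat (t xs) (\<lambda>_ r. r div 2) (s xs))"
    by (intro recfn_rec half recfn_base assms)
  ultimately have "recfn n (\<lambda>xs. t xs div 2 ^ s xs)"
    by (simp add: rec_nat_funpow)
  then have "recrel n (\<lambda>xs. (t xs div 2 ^ s xs) mod 2 = 1)"
    by (intro recrel_eq parity recfn_const)
  then show ?thesis
    by (simp add: set_decode_def odd_iff_mod_2_eq_one)
qed

subsection \<open>The existential predicates\<close>

definition sigma1 :: "nat \<Rightarrow> (nat list \<Rightarrow> bool) \<Rightarrow> bool" where
  "sigma1 n P \<longleftrightarrow> (\<exists>q. recfn (Suc n) q \<and> (\<forall>xs. length xs = n \<longrightarrow> (P xs \<longleftrightarrow> (\<exists>y. q (y # xs) = 0))))"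

lemma sigma1I:
  assumes "recrel (Suc n) (\<lambda>xs. Q (hd xs) (tl xs))"
    and "\<And>xs. length xs = n \<Longrightarrow> P xs \<longleftrightarrow> (\<exists>y. Q y xs)"
  shows "sigma1 n P"
  using assms unfolding sigma1_def recrel_def
  by (intro exI[of _ "\<lambda>xs. if Q (hd xs) (tl xs) then 0 else 1"]) (auto split: if_splits)

lemma sigma1_recrel: "recrel n P \<Longrightarrow> sigma1 n P"
  unfolding recrel_def sigma1_def by (intro exI conjI, erule recfn_tl) auto

text \<open>The pairing function merges the two witnesses into one.\<close>

lemma sigma1_conj:
  assumes "sigma1 n P" "sigma1 n Q"
  shows "sigma1 n (\<lambda>xs. P xs \<and> Q xs)"
proof -
  obtain p q where p: "recfn (Suc n) p" "\<And>xs. length xs = n \<Longrightarrow> P xs \<longleftrightarrow> (\<exists>y. p (y # xs) = 0)"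
    and q: "recfn (Suc n) q" "\<And>xs. length xs = n \<Longrightarrow> Q xs \<longleftrightarrow> (\<exists>y. q (y # xs) = 0)"
    using assms unfolding sigma1_def by metis
  have "recfn (Suc n) (\<lambda>xs. p (pfst (hd xs) # tl xs))"
    using recfn_subst[of "[\<lambda>xs. pfst (hd xs)]" n p 1] p(1)
    by (simp add: drop_Suc recfn_pfst recfn_hd)
  moreover have "recfn (Suc n) (\<lambda>xs. q (psnd (hd xs) # tl xs))"
    using recfn_subst[of "[\<lambda>xs. psnd (hd xs)]" n q 1] q(1)
    by (simp add: drop_Suc recfn_psnd recfn_hd)
  ultimately have "recrel (Suc n) (\<lambda>xs. p (pfst (hd xs) # tl xs) = 0 \<and> q (psnd (hd xs) # tl xs) = 0)"
    by (intro recrel_conj recrel_eq recfn_const)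
  then show ?thesis
    by (rule sigma1I[where Q = "\<lambda>y xs. p (pfst y # xs) = 0 \<and> q (psnd y # xs) = 0"])
      (metis p(2) q(2) pfst_prod_encode psnd_prod_encode)
qed

lemma sigma1_disj:
  assumes "sigma1 n P" "sigma1 n Q"
  shows "sigma1 n (\<lambda>xs. P xs \<or> Q xs)"
proof -
  obtain p q where p: "recfn (Suc n) p" "\<And>xs. length xs = n \<Longrightarrow> P xs \<longleftrightarrow> (\<exists>y. p (y # xs) = 0)"
    and q: "recfn (Suc n) q" "\<And>xs. length xs = n \<Longrightarrow> Q xs \<longleftrightarrow> (\<exists>y. q (y # xs) = 0)"
    using assms unfolding sigma1_def by metis
  have "recrel (Suc n) (\<lambda>xs. p xs = 0 \<or> q xs = 0)"
    by (intro recrel_disj recrel_eq recfn_const p(1) q(1))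
  then have "recfn (Suc n) (\<lambda>xs. if p xs = 0 \<or> q xs = 0 then 0 else 1)"
    by (simp add: recrel_def)
  then show ?thesis
    unfolding sigma1_def using p(2) q(2)
    by (intro exI[of _ "\<lambda>xs. if p xs = 0 \<or> q xs = 0 then 0 else 1"])
      (auto simp: ex_disj_distrib split: if_splits)
qed

text \<open>One number codes a witness for the matrix together with the value of
  \<open>y\<close>.\<close>

lemma sigma1_ex:
  assumes "sigma1 (Suc n) (\<lambda>xs. P (hd xs) (tl xs))"
  shows "sigma1 n (\<lambda>xs. \<exists>y. P y xs)"
proof -
  obtain p where p: "recfn (Suc (Suc n)) p"
    "\<And>xs. length xs = Suc n \<Longrightarrow> P (hd xs) (tl xs) \<longleftrightarrow> (\<exists>y. p (y # xs) = 0)"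
    using assms unfolding sigma1_def by metis
  have P: "P x xs \<longleftrightarrow> (\<exists>y. p (y # x # xs) = 0)" if "length xs = n" for x xs
    using p(2)[of "x # xs"] that by simp
  have "recfn (Suc n) (\<lambda>xs. p (pfst (hd xs) # psnd (hd xs) # tl xs))"
    using recfn_subst[of "[\<lambda>xs. pfst (hd xs), \<lambda>xs. psnd (hd xs)]" n p 1] p(1)
    by (force simp: drop_Suc intro: recfn_pfst recfn_psnd recfn_hd)
  then have "recrel (Suc n) (\<lambda>xs. p (pfst (hd xs) # psnd (hd xs) # tl xs) = 0)"
    by (intro recrel_eq recfn_const)
  then show ?thesis
    by (rule sigma1I[where Q = "\<lambda>y xs. p (pfst y # psnd y # xs) = 0"])
      (metis P pfst_prod_encode psnd_prod_encode)
qed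

text \<open>Collection: finitely many witnesses have a common bound.\<close>

lemma sigma1_ball_less:
  assumes "sigma1 (Suc n) (\<lambda>xs. P (hd xs) (tl xs))" and t: "recfn n t"
  shows "sigma1 n (\<lambda>xs. \<forall>a<t xs. P a xs)"
proof -
  obtain p where p: "recfn (Suc (Suc n)) p"
    "\<And>xs. length xs = Suc n \<Longrightarrow> P (hd xs) (tl xs) \<longleftrightarrow> (\<exists>y. p (y # xs) = 0)"
    using assms(1) unfolding sigma1_def by metis
  have P: "P x xs \<longleftrightarrow> (\<exists>y. p (y # x # xs) = 0)" if "length xs = n" for x xs
    using p(2)[of "x # xs"] that by simp
  \<comment> \<open>The leading arguments are the witness \<open>m\<close>, the element
    \<open>a\<close> and the bound \<open>M\<close>; \<open>p\<close> takes the first two and skips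
    \<open>M\<close>.\<close>
  have "recfn (Suc (Suc (Suc n))) (\<lambda>xs. p (hd xs # hd (tl xs) # tl (tl (tl xs))))"
    using recfn_subst[of "[hd, \<lambda>xs. hd (tl xs)]" n p 3] p(1)
    by (force simp: drop_Suc numeral_3_eq_3 intro: recfn_base)
  then have "recrel (Suc n) (\<lambda>xs. \<forall>a<t (tl xs). \<exists>m<hd xs. p (m # a # tl xs) = 0)"
    by (intro recrel_ball_less recrel_bex_less recrel_eq recfn_const recfn_hd recfn_tl t)
  moreover have "(\<forall>a<k. P a xs) \<longleftrightarrow> (\<exists>M. \<forall>a<k. \<exists>m<M. p (m # a # xs) = 0)"
    if len: "length xs = n" for xs k
  proof
    assume "\<forall>a<k. P a xs"
    then obtain w where w: "\<And>a. a < k \<Longrightarrow> p (w a # a # xs) = 0"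
      unfolding P[OF len] by metis
    have "w a < Suc (\<Sum>i<k. w i)" if "a < k" for a
      using member_le_sum[of a "{..<k}" w] that by simp
    then show "\<exists>M. \<forall>a<k. \<exists>m<M. p (m # a # xs) = 0"
      using w by blast
  qed (use P[OF len] in blast)
  ultimately show ?thesis
    by (rule sigma1I[where Q = "\<lambda>M xs. \<forall>a<t xs. \<exists>m<M. p (m # a # xs) = 0"])
qed

section \<open>Recursively enumerable sets as existential predicates\<close>

lemma sigma1_re_set:
  assumes "re_set A" "recfn n t"
  shows "sigma1 n (\<lambda>xs. t xs \<in> A)"
proof (cases "A = {}")
  case True
  then show ?thesis
    using sigma1_recrel[OF recrel_eq[OF recfn_const[of n 0] recfn_const[of n 1]]] by simp
next
  case False
  then obtain f where f: "recfn 1 f" "A = range (\<lambda>k. f [k])"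
    using assms(1) unfolding re_set_def by blast
  have "recfn (Suc n) (\<lambda>xs. f [hd xs])"
    using recfn.comp[of "[hd]" f "Suc n"] f(1) recfn_hd by simp
  then have "sigma1 n (\<lambda>xs. \<exists>k. t xs = f [k])"
    by (intro sigma1_ex sigma1_recrel recrel_eq recfn_tl assms(2))
  then show ?thesis
    by (simp add: f(2) image_iff)
qed

text \<open>Run through all pairs of a possible witness and a candidate; output the candidate if the
  witness is correct and a fixed element of \<open>A\<close> otherwise, which makes the enumeration
  total.\<close>

lemma re_set_sigma1:
  assumes "sigma1 1 (\<lambda>xs. hd xs \<in> A)"
  shows "re_set A"
proof (cases "A = {}")
  case False
  then obtain a where a: "a \<in> A"
    by blast
  obtain q where q: "recfn 2 q" "\<And>xs. length xs = 1 \<Longrightarrow> hd xs \<in> A \<longleftrightarrow> (\<exists>y. q (y # xs) = 0)"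
    using assms unfolding sigma1_def by (auto simp: numeral_2_eq_2)
  have A: "x \<in> A \<longleftrightarrow> (\<exists>y. q [y, x] = 0)" for x
    using q(2)[of "[x]"] by simp
  define f where "f = (\<lambda>xs. if q [pfst (hd xs), psnd (hd xs)] = 0 then psnd (hd xs) else a)"
  have "recfn (Suc 0) (\<lambda>xs. q [pfst (hd xs), psnd (hd xs)])"
    using recfn.comp[of "[\<lambda>xs. pfst (hd xs), \<lambda>xs. psnd (hd xs)]" q "Suc 0"] q(1)
    by (force simp: numeral_2_eq_2 intro: recfn_pfst recfn_psnd recfn_hd)
  then have "recfn 1 f"
    unfolding f_def One_nat_def by (intro recfn_if recrel_eq recfn_psnd recfn_hd recfn_const)
  moreover have "A = range (\<lambda>k. f [k])"
  proof
    show "A \<subseteq> range (\<lambda>k. f [k])"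
    proof
      fix x assume "x \<in> A"
      then obtain y where "q [y, x] = 0"
        using A by blast
      then have "x = f [prod_encode (y, x)]"
        by (simp add: f_def)
      then show "x \<in> range (\<lambda>k. f [k])"
        by blast
    qed
    show "range (\<lambda>k. f [k]) \<subseteq> A"
      using a A by (auto simp: f_def)
  qed
  ultimately show ?thesis
    unfolding re_set_def by blast
qed (simp add: re_set_def)

lemma sigma1_re_set2:
  assumes "re_set2 A" "recfn n s" "recfn n t"
  shows "sigma1 n (\<lambda>xs. (s xs, t xs) \<in> A)"
proof -
  have "sigma1 n (\<lambda>xs. prod_encode (s xs, t xs) \<in> prod_encode ` A)"
    using assms unfolding re_set2_def by (intro sigma1_re_set recfn_prod_encode)
  then show ?thesis
    by (simp add: inj_image_mem_iff[OF inj_prod_encode])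
qed

lemma sigma1_re_set3:
  assumes "re_set3 A" "recfn n r" "recfn n s" "recfn n t"
  shows "sigma1 n (\<lambda>xs. (r xs, s xs, t xs) \<in> A)"
proof -
  let ?c = "\<lambda>(a, b, c). prod_encode (a, prod_encode (b, c))"
  have "sigma1 n (\<lambda>xs. prod_encode (r xs, prod_encode (s xs, t xs)) \<in> ?c ` A)"
    using assms unfolding re_set3_def by (intro sigma1_re_set recfn_prod_encode)
  moreover have "prod_encode (a, prod_encode (b, c)) \<in> ?c ` A \<longleftrightarrow> (a, b, c) \<in> A" for a b c
    by force
  ultimately show ?thesis
    by simp
qed

lemma re_set2_sigma1:
  assumes "sigma1 1 (\<lambda>xs. (pfst (hd xs), psnd (hd xs)) \<in> A)"
  shows "re_set2 A"
proof -
  have "z \<in> prod_encode ` A \<longleftrightarrow> (pfst z, psnd z) \<in> A" for z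
    by (metis image_iff prod_encode_eq prod_encode_pfst_psnd)
  with assms show ?thesis
    unfolding re_set2_def by (intro re_set_sigma1) simp
qed

subsection \<open>Finite intersections of basic sets\<close>

text \<open>
  \<open>U (b u)\<close> is a basic subset of \<open>U a\<close> for each \<open>a \<in> set_decode u\<close>. The first conjunct is a recursively
  enumerable substitute for \<open>b 0 \<in> I\<close>; the bound \<open>a < u\<close> suffices by \<open>set_decode_less\<close>.
\<close>

definition intersection_chain :: "(nat \<times> nat \<times> nat) set \<Rightarrow> nat \<Rightarrow> (nat \<Rightarrow> nat) \<Rightarrow> bool" where
  "intersection_chain H u b \<longleftrightarrow> (\<exists>i. (b 0, b 0, i) \<in> H) \<and>
     (\<forall>a<u. (a \<notin> set_decode u \<and> b (Suc a) = b a) \<or> (a \<in> set_decode u \<and> (b a, a, b (Suc a)) \<in> H))"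

lemma set_decode_less:
  assumes "a \<in> set_decode u"
  shows "a < u"
proof -
  from assms have "u div 2 ^ a \<noteq> 0"
    by (auto simp: set_decode_def intro: Nat.gr0I)
  then have "2 ^ a \<le> u"
    by (simp add: div_eq_0_iff)
  then show "a < u"
    using less_exp[of a] by linarith
qed

context
  fixes H :: "(nat \<times> nat \<times> nat) set" and I :: "nat set" and U :: "nat \<Rightarrow> 'a set"
  assumes H: "H \<subseteq> I \<times> I \<times> I"
    and inter: "\<forall>i1\<in>I. \<forall>i2\<in>I. U i1 \<inter> U i2 = \<Union>{U i | i. (i1, i2, i) \<in> H}"
begin

text \<open>By induction on \<open>n\<close>, the set \<open>U (b n)\<close> lies in
  \<open>U a\<close> for all \<open>a < n\<close> in \<open>set_decode u\<close>; at
  \<open>n = u\<close> this covers all of \<open>set_decode u\<close> by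
  \<open>set_decode_less\<close>.\<close>

lemma intersection_chain_sound:
  assumes "intersection_chain H u b"
  shows "b u \<in> I" and "x \<in> U (b u) \<Longrightarrow> set_decode u \<subseteq> index_set I U x"
proof -
  have *: "b n \<in> I \<and> (x \<in> U (b n) \<longrightarrow> (\<forall>a\<in>set_decode u. a < n \<longrightarrow> a \<in> I \<and> x \<in> U a))" if "n \<le> u" for n x
    using that
  proof (induction n)
    case 0
    then show ?case
      using assms H by (auto simp: intersection_chain_def)
  next
    case (Suc n)
    then have IH: "b n \<in> I" "x \<in> U (b n) \<Longrightarrow> \<forall>a\<in>set_decode u. a < n \<longrightarrow> a \<in> I \<and> x \<in> U a"
      by auto
    consider "n \<notin> set_decode u" "b (Suc n) = b n" | "n \<in> set_decode u" "(b n, n, b (Suc n)) \<in> H"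
      using assms Suc.prems unfolding intersection_chain_def by (meson Suc_le_lessD)
    then show ?case
    proof cases
      case 1
      then show ?thesis
        using IH by (auto simp: less_Suc_eq)
    next
      case 2
      \<comment> \<open>That \<open>n\<close> belongs to \<open>I\<close> is read off the triple in
        \<open>H\<close>.\<close>
      then have "n \<in> I" "b (Suc n) \<in> I"
        using H by auto
      moreover have "U (b (Suc n)) \<subseteq> U (b n) \<inter> U n"
        using 2 inter[rule_format, OF IH(1) \<open>n \<in> I\<close>] by blast
      ultimately show ?thesis
        using IH by (auto simp: less_Suc_eq)
    qed
  qed
  show "b u \<in> I"
    using * by blast
  show "set_decode u \<subseteq> index_set I U x" if "x \<in> U (b u)"
    using *[of u x] that set_decode_less by (auto simp: index_set_def)
qed

text \<open>Start at \<open>i\<close> and keep \<open>x\<close> inside: whenever \<open>x\<close>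
  lies in \<open>U p \<inter> U a\<close>, some \<open>U q\<close> in the union given by
  \<open>H\<close> contains it. Dependent choice strings these indices together.\<close>

lemma intersection_chain_complete:
  assumes i: "i \<in> I" "x \<in> U i" and u: "set_decode u \<subseteq> index_set I U x"
  shows "\<exists>b. intersection_chain H u b \<and> x \<in> U (b u)"
proof -
  define Q where "Q = (\<lambda>a p q. q \<in> I \<and> x \<in> U q \<and>
    ((a \<notin> set_decode u \<and> q = p) \<or> (a \<in> set_decode u \<and> (p, a, q) \<in> H)))"
  have "\<exists>q. Q a p q" if p: "p \<in> I \<and> x \<in> U p" for a p
  proof (cases "a \<in> set_decode u")
    case True
    then have "a \<in> I" "x \<in> U p \<inter> U a"
      using u p by (auto simp: index_set_def)
    then obtain q where "(p, a, q) \<in> H" "x \<in> U q"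
      using inter[rule_format, of p a] p by blast
    then show ?thesis
      using True H unfolding Q_def by blast
  qed (use p in \<open>auto simp: Q_def\<close>)
  \<comment> \<open>The condition for \<open>n = 0\<close> pins the start to \<open>i\<close>; at
    \<open>Suc n\<close> it is vacuous.\<close>
  then have step: "\<exists>q. (q \<in> I \<and> x \<in> U q \<and> (Suc n = 0 \<longrightarrow> q = i)) \<and> Q n p q"
    if "p \<in> I \<and> x \<in> U p \<and> (n = 0 \<longrightarrow> p = i)" for n p
    using that unfolding Q_def by blast
  have "\<exists>p. p \<in> I \<and> x \<in> U p \<and> ((0 :: nat) = 0 \<longrightarrow> p = i)"
    using i by blast
  from dependent_nat_choice[of "\<lambda>n p. p \<in> I \<and> x \<in> U p \<and> (n = 0 \<longrightarrow> p = i)" Q, OF this step]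
  obtain b where b: "b 0 = i" "\<And>a. x \<in> U (b a)" "\<And>a. Q a (b a) (b (Suc a))"
    by blast
  \<comment> \<open>Since \<open>x\<close> lies in \<open>U i \<inter> U i\<close>, the union for
    the pair \<open>(i, i)\<close> is nonempty, which gives the enumerable start condition.\<close>
  have "\<exists>k. (b 0, b 0, k) \<in> H"
    using inter[rule_format, of i i] i b(1) by blast
  then show ?thesis
    using b(2,3) unfolding intersection_chain_def Q_def by blast
qed

end

lemma intersection_chain_cong:
  "(\<And>a. a \<le> u \<Longrightarrow> b a = b' a) \<Longrightarrow> intersection_chain H u b \<longleftrightarrow> intersection_chain H u b'"
  unfolding intersection_chain_def by (simp add: Suc_leI)

text \<open>A chain depends only on \<open>b 0\<close> up to \<open>b u\<close>, so a quantifier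
  over functions can be turned into one over numbers, as existential predicates demand.\<close>

lemma ex_intersection_chain_seq_nth:
  "(\<exists>b. intersection_chain H u b \<and> b u = i) \<longleftrightarrow>
   (\<exists>c. intersection_chain H u (seq_nth c) \<and> seq_nth c u = i)"
proof
  assume "\<exists>b. intersection_chain H u b \<and> b u = i"
  then obtain b where b: "intersection_chain H u b" "b u = i"
    by blast
  obtain c where "\<forall>a\<le>u. seq_nth c a = b a"
    using ex_seq_nth by blast
  then show "\<exists>c. intersection_chain H u (seq_nth c) \<and> seq_nth c u = i"
    using b intersection_chain_cong[of u "seq_nth c" b H] by auto
qed blast

lemma sigma1_intersection_chain:
  assumes "re_set3 H" "recfn n s" "recfn n t"
  shows "sigma1 n (\<lambda>xs. intersection_chain H (s xs) (seq_nth (t xs)))"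
  unfolding intersection_chain_def
  by (rule sigma1_conj sigma1_ex sigma1_ball_less sigma1_disj sigma1_re_set3[OF assms(1)]
      sigma1_recrel[OF recrel_not[OF recrel_set_decode]] sigma1_recrel[OF recrel_set_decode]
      sigma1_recrel[OF recrel_eq] recfn_seq_nth recfn_base assms(2,3))+

section \<open>The enumerable approximation system\<close>

theorem theorem2p10:
  fixes X :: "'a topology" and Y :: "'b topology"
    and I J :: "nat set" and U :: "nat \<Rightarrow> 'a set" and V :: "nat \<Rightarrow> 'b set"
    and E :: "'a set" and f :: "'a \<Rightarrow> 'b" and H :: "(nat \<times> nat \<times> nat) set"
  assumes "indexed_base X I U"
    and "indexed_base Y J V"
    and "E \<subseteq> topspace X"
    and "f \<in> E \<rightarrow> topspace Y"
    and "re_set J"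
    and "H \<subseteq> I \<times> I \<times> I"
    and "re_set3 H"
    and "\<And>i1 i2. i1 \<in> I \<Longrightarrow> i2 \<in> I \<Longrightarrow> U i1 \<inter> U i2 = \<Union>{U i | i. (i1, i2, i) \<in> H}"
    and "computable_wrt I U J V E f"
  shows "\<exists>R. approximation_system I U J V E f R \<and> re_set2 R"
proof -
  obtain F W where W: "re_set2 W" "\<And>A. F A = {j. \<exists>u. (j, u) \<in> W \<and> set_decode u \<subseteq> A}"
    and F: "\<And>x. x \<in> E \<Longrightarrow> index_set J V (f x) = F (index_set I U x)"
    using assms(9) unfolding computable_wrt_def enumeration_operator_def by blast
  define R where "R = {(i, j). j \<in> J \<and>
    (\<exists>u. (j, u) \<in> W \<and> (\<exists>c. intersection_chain H u (seq_nth c) \<and> seq_nth c u = i))}"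
  have inter: "\<forall>i1\<in>I. \<forall>i2\<in>I. U i1 \<inter> U i2 = \<Union>{U i | i. (i1, i2, i) \<in> H}"
    using assms(8) by blast
  note sound = intersection_chain_sound[OF assms(6) inter]
    and complete = intersection_chain_complete[OF assms(6) inter]
  have "f x \<in> V j \<longleftrightarrow> (\<exists>i. (i, j) \<in> R \<and> x \<in> U i)" if x: "x \<in> E" and j: "j \<in> J" for x j
  proof -
    \<comment> \<open>The whole space is a union of basic sets, so \<open>x\<close> lies in some
      \<open>U i\<close>; a chain can start there even if \<open>set_decode u\<close> is
      empty.\<close>
    obtain K where K: "K \<subseteq> I" "topspace X = (\<Union>i\<in>K. U i)"
      using assms(1) openin_topspace[of X] unfolding indexed_base_def by blast
    then obtain i where i: "i \<in> I" "x \<in> U i"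
      using x assms(3) by blast
    have "f x \<in> V j \<longleftrightarrow> j \<in> F (index_set I U x)"
      using F[OF x] j by (auto simp: index_set_def)
    also have "\<dots> \<longleftrightarrow> (\<exists>u. (j, u) \<in> W \<and> set_decode u \<subseteq> index_set I U x)"
      by (simp add: W(2))
    \<comment> \<open>Completeness, started at \<open>i\<close>, gives one direction and soundness
      the other.\<close>
    also have "\<dots> \<longleftrightarrow> (\<exists>u. (j, u) \<in> W \<and> (\<exists>b. intersection_chain H u b \<and> x \<in> U (b u)))"
      using complete[OF i] sound(2) by blast
    also have "\<dots> \<longleftrightarrow> (\<exists>i. (i, j) \<in> R \<and> x \<in> U i)"
      using j unfolding R_def ex_intersection_chain_seq_nth[symmetric] by blast
    finally show ?thesis .
  qed
  moreover have "R \<subseteq> I \<times> J"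
    using sound(1) unfolding R_def by blast
  moreover have "re_set2 R"
  proof (rule re_set2_sigma1)
    \<comment> \<open>Here the enumerability of \<open>J\<close>, \<open>W\<close> and
      \<open>H\<close> enters; chains are quantified through their codes.\<close>
    have "sigma1 (Suc 0) (\<lambda>xs. psnd (hd xs) \<in> J \<and> (\<exists>u. (psnd (hd xs), u) \<in> W \<and>
      (\<exists>c. intersection_chain H u (seq_nth c) \<and> seq_nth c u = pfst (hd xs))))"
      by (intro sigma1_conj sigma1_ex sigma1_re_set[OF assms(5)] sigma1_re_set2[OF W(1)]
          sigma1_intersection_chain[OF assms(7)] sigma1_recrel[OF recrel_eq]
          recfn_seq_nth recfn_pfst recfn_psnd recfn_base)
    then show "sigma1 1 (\<lambda>xs. (pfst (hd xs), psnd (hd xs)) \<in> R)"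
      by (simp add: R_def)
  qed
  ultimately show ?thesis
    unfolding approximation_system_def by blast
qed

end
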